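(* Let $C_N$ be a cyclic group of order $N$ (written multiplicatively) with generator $\gamma$, let $d_1,\dots,d_m$ be positive divisors of $N$, and let $m_1,\dots,m_m$ be positive integers. For each $i=1,\dots,m$ and $x=(x_1,\dots,x_{m_i}),\,y=(y_1,\dots,y_{m_i})\in\mathbb{Z}_{d_i}^{m_i}$, let $x\cdot y=\sum_{j=1}^{m_i}x_jy_j\bmod d_i$. Then the map $$\langle\cdot\mid\cdot\rangle\colon\bigoplus_{i=1}^m\mathbb{Z}_{d_i}^{m_i}\times\bigoplus_{i=1}^m\mathbb{Z}_{d_i}^{m_i}\rightarrow C_N,\qquad \langle(x^{(1)},\dots,x^{(m)})\mid(y^{(1)},\dots,y^{(m)})\rangle=\prod_{i=1}^m\gamma^{\frac{N}{d_i}\,x^{(i)}\cdot y^{(i)}}$$ (where $x^{(i)},y^{(i)}\in\mathbb{Z}_{d_i}^{m_i}$ for $i=1,\dots,m$) is a pairing.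
   Context: $\mathbb{Z}_d$ denotes the group (ring) of integers modulo $d$. For abelian groups $A,B$ (additive) and $C$ (multiplicative), a map $f\colon A\times B\to C$ is bilinear if it is a group homomorphism in each variable separately. A bilinear map is left non-degenerate if $f(a,b)=1_C$ for every $b\in B$ implies $a=0_A$; right non-degenerate if $f(a,b)=1_C$ for every $a\in A$ implies $b=0_B$; and non-degenerate if it is both. A pairing is a non-degenerate bilinear map. *)

theory Defs
  imports "HOL-Algebra.Product_Groups" "HOL-Algebra.FiniteProduct"
begin

text \<open>
  In HOL-Algebra every group is written with the operation \<open>\<otimes>\<close> and the unit \<open>\<one>\<close>; the groups
  \<open>A\<close> and \<open>B\<close> below are the ones written additively on paper, so \<open>\<one>\<^bsub>A\<^esub>\<close> and \<open>\<one>\<^bsub>B\<^esub>\<close> are their zeros.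
\<close>

locale bilinear_map =
  A: comm_group A + B: comm_group B + C: comm_group C
  for A :: "('a, 'd) monoid_scheme" and B :: "('b, 'e) monoid_scheme"
    and C :: "('c, 'f) monoid_scheme" +
  fixes f :: "'a \<Rightarrow> 'b \<Rightarrow> 'c"
  assumes hom_left: "b \<in> carrier B \<Longrightarrow> (\<lambda>a. f a b) \<in> hom A C"
    and hom_right: "a \<in> carrier A \<Longrightarrow> (\<lambda>b. f a b) \<in> hom B C"

definition left_nondegenerate ::
    "('a, 'd) monoid_scheme \<Rightarrow> ('b, 'e) monoid_scheme \<Rightarrow> ('c, 'f) monoid_scheme
      \<Rightarrow> ('a \<Rightarrow> 'b \<Rightarrow> 'c) \<Rightarrow> bool" where
  "left_nondegenerate A B C f \<longleftrightarrow>
     (\<forall>a\<in>carrier A. (\<forall>b\<in>carrier B. f a b = \<one>\<^bsub>C\<^esub>) \<longrightarrow> a = \<one>\<^bsub>A\<^esub>)"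

definition right_nondegenerate ::
    "('a, 'd) monoid_scheme \<Rightarrow> ('b, 'e) monoid_scheme \<Rightarrow> ('c, 'f) monoid_scheme
      \<Rightarrow> ('a \<Rightarrow> 'b \<Rightarrow> 'c) \<Rightarrow> bool" where
  "right_nondegenerate A B C f \<longleftrightarrow>
     (\<forall>b\<in>carrier B. (\<forall>a\<in>carrier A. f a b = \<one>\<^bsub>C\<^esub>) \<longrightarrow> b = \<one>\<^bsub>B\<^esub>)"

locale pairing = bilinear_map +
  assumes left_nondegenerate: "left_nondegenerate A B C f"
    and right_nondegenerate: "right_nondegenerate A B C f"

text \<open>
  \<open>integer_mod_group d\<close> is realised on the representatives \<open>{0..<int d}\<close> for \<open>d > 0\<close>, and elements
  of \<open>product_group\<close> and \<open>sum_group\<close> are functions that are \<open>undefined\<close> outside the index set.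
\<close>

definition Zmod_power :: "nat \<Rightarrow> nat \<Rightarrow> (nat \<Rightarrow> int) monoid" where
  "Zmod_power d n = product_group {1..n} (\<lambda>_. integer_mod_group d)"

definition dot_mod :: "nat \<Rightarrow> nat \<Rightarrow> (nat \<Rightarrow> int) \<Rightarrow> (nat \<Rightarrow> int) \<Rightarrow> int" where
  "dot_mod d n x y = (\<Sum>j=1..n. x j * y j) mod int d"

definition Zmod_sum :: "nat \<Rightarrow> (nat \<Rightarrow> nat) \<Rightarrow> (nat \<Rightarrow> nat) \<Rightarrow> (nat \<Rightarrow> nat \<Rightarrow> int) monoid" where
  "Zmod_sum m d n = sum_group {1..m} (\<lambda>i. Zmod_power (d i) (n i))"

definition cyclic_bracket ::
    "('c, 'f) monoid_scheme \<Rightarrow> 'c \<Rightarrow> nat \<Rightarrow> nat \<Rightarrow> (nat \<Rightarrow> nat) \<Rightarrow> (nat \<Rightarrow> nat)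
      \<Rightarrow> (nat \<Rightarrow> nat \<Rightarrow> int) \<Rightarrow> (nat \<Rightarrow> nat \<Rightarrow> int) \<Rightarrow> 'c" where
  "cyclic_bracket C \<gamma> N m d n x y =
     (\<Otimes>\<^bsub>C\<^esub>i\<in>{1..m}. \<gamma> [^]\<^bsub>C\<^esub> (int (N div d i) * dot_mod (d i) (n i) (x i) (y i)))"

end

(* By symmetry only the left variable matters. Since gamma has order N, the power
   gamma^((N/d) s) depends only on s modulo d, so the reductions in the dot products are
   harmless and additivity is that of the integer dot product. Pairing x with the standard basis
   vector at position (i, j) gives gamma^((N/d_i) x_ij), which is trivial only if d_i divides x_ij. *)

theory Submission
  imports Defs "HOL-Algebra.Multiplicative_Group"
begin

lemma comm_group_Zmod_sum: "comm_group (Zmod_sum m d n)"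
  unfolding Zmod_sum_def Zmod_power_def
  by (rule group.group_comm_groupI) (auto simp: fun_eq_iff restrict_def add.commute)

text \<open>The finite-support condition in \<open>sum_group\<close> is vacuous over the finite
  index set \<open>{1..m}\<close>, which leaves the full product.\<close>

lemma carrier_Zmod_sum:
  "carrier (Zmod_sum m d n) =
     (\<Pi>\<^sub>E i\<in>{1..m}. \<Pi>\<^sub>E j\<in>{1..n i}. carrier (integer_mod_group (d i)))"
  by (simp add: Zmod_sum_def Zmod_power_def carrier_sum_group)

lemma one_Zmod_sum: "\<one>\<^bsub>Zmod_sum m d n\<^esub> = (\<lambda>i\<in>{1..m}. \<lambda>j\<in>{1..n i}. 0)"
  by (simp add: Zmod_sum_def Zmod_power_def)

lemma mult_Zmod_sum:
  "i \<in> {1..m} \<Longrightarrow> j \<in> {1..n i} \<Longrightarrow>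
     (x \<otimes>\<^bsub>Zmod_sum m d n\<^esub> y) i j = (x i j + y i j) mod int (d i)"
  by (simp add: Zmod_sum_def Zmod_power_def)

lemma dot_mod_commute: "dot_mod d n x y = dot_mod d n y x"
  by (simp add: dot_mod_def mult.commute)

text \<open>Both sides are the same sum taken modulo \<open>d\<close>, since each summand may be
  reduced first. The entries of \<open>z\<close> are prescribed only on \<open>{1..n}\<close>, which
  is all that \<open>mult_Zmod_sum\<close> provides for a product in the group.\<close>

lemma dot_mod_add_left:
  assumes "\<And>j. j \<in> {1..n} \<Longrightarrow> z j = (x j + x' j) mod int d"
  shows "dot_mod d n z y = (dot_mod d n x y + dot_mod d n x' y) mod int d"
proof -
  have "dot_mod d n z y = (\<Sum>j=1..n. (z j * y j) mod int d) mod int d"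
    by (simp add: dot_mod_def mod_sum_eq)
  also have "(\<Sum>j=1..n. (z j * y j) mod int d) = (\<Sum>j=1..n. (x j * y j + x' j * y j) mod int d)"
    by (rule sum.cong) (simp_all add: assms mod_mult_left_eq flip: distrib_right)
  also have "\<dots> mod int d = (dot_mod d n x y + dot_mod d n x' y) mod int d"
    by (simp add: dot_mod_def mod_sum_eq sum.distrib mod_add_eq)
  finally show ?thesis .
qed

lemma dot_mod_single:
  assumes "j \<in> {1..n}"
    and "\<And>k. k \<in> {1..n} \<Longrightarrow> e k = (if k = j then 1 mod int d else 0)"
  shows "dot_mod d n x e = x j mod int d"
proof -
  have "(\<Sum>k=1..n. x k * e k) = (\<Sum>k=1..n. if k = j then x j * (1 mod int d) else 0)"
    by (rule sum.cong) (simp_all add: assms(2))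
  then show ?thesis
    using assms(1) by (simp add: dot_mod_def mod_mult_right_eq)
qed

lemma cyclic_bracket_commute: "cyclic_bracket C \<gamma> N m d n x y = cyclic_bracket C \<gamma> N m d n y x"
  by (simp add: cyclic_bracket_def dot_mod_commute)

text \<open>The two exponents differ by \<open>N div d\<close> times a multiple of \<open>d\<close>,
  hence by a multiple of \<open>N\<close>, which the order of \<open>x\<close> divides.\<close>

lemma (in group) pow_div_mod:
  assumes "x \<in> carrier G" "int (ord x) dvd int N" "d dvd N"
  shows "x [^] (int (N div d) * (s mod int d)) = x [^] (int (N div d) * s)"
proof -
  have "int (N div d) * (s - s mod int d) = int N * (s div int d)"
    using assms(3) by (auto simp: minus_mod_eq_mult_div elim!: dvdE)
  then have "int (ord x) dvd int (N div d) * s - int (N div d) * (s mod int d)"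
    using assms(2) by (simp flip: right_diff_distrib)
  then show ?thesis
    using assms(1) by (simp add: int_pow_eq)
qed

text \<open>Each factor splits by \<open>dot_mod_add_left\<close>, with \<open>pow_div_mod\<close>
  absorbing the outer reduction; commutativity then separates the product over \<open>i\<close> into
  two.\<close>

lemma (in comm_group) cyclic_bracket_mult_left:
  assumes "\<gamma> \<in> carrier G" "ord \<gamma> dvd N" "\<And>i. i \<in> {1..m} \<Longrightarrow> d i dvd N"
  shows "cyclic_bracket G \<gamma> N m d n (x \<otimes>\<^bsub>Zmod_sum m d n\<^esub> x') y =
         cyclic_bracket G \<gamma> N m d n x y \<otimes> cyclic_bracket G \<gamma> N m d n x' y"
proof -
  have "\<gamma> [^] (int (N div d i) * dot_mod (d i) (n i) ((x \<otimes>\<^bsub>Zmod_sum m d n\<^esub> x') i) (y i)) =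
        \<gamma> [^] (int (N div d i) * dot_mod (d i) (n i) (x i) (y i)) \<otimes>
        \<gamma> [^] (int (N div d i) * dot_mod (d i) (n i) (x' i) (y i))"
    if i: "i \<in> {1..m}" for i
  proof -
    have "dot_mod (d i) (n i) ((x \<otimes>\<^bsub>Zmod_sum m d n\<^esub> x') i) (y i) =
          (dot_mod (d i) (n i) (x i) (y i) + dot_mod (d i) (n i) (x' i) (y i)) mod int (d i)"
      by (rule dot_mod_add_left) (rule mult_Zmod_sum[OF i])
    then show ?thesis
      using assms i by (simp add: pow_div_mod distrib_left int_pow_mult)
  qed
  then have "cyclic_bracket G \<gamma> N m d n (x \<otimes>\<^bsub>Zmod_sum m d n\<^esub> x') y =
      (\<Otimes>i\<in>{1..m}. \<gamma> [^] (int (N div d i) * dot_mod (d i) (n i) (x i) (y i)) \<otimes>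
        \<gamma> [^] (int (N div d i) * dot_mod (d i) (n i) (x' i) (y i)))"
    unfolding cyclic_bracket_def by (intro finprod_cong') (use assms(1) in auto)
  then show ?thesis
    using assms(1) by (simp add: cyclic_bracket_def Pi_iff)
qed

lemma (in comm_group) cyclic_bracket_left_nondegenerate:
  assumes "\<gamma> \<in> carrier G" "ord \<gamma> = N" "N > 0"
    and d: "\<And>i. i \<in> {1..m} \<Longrightarrow> d i > 0 \<and> d i dvd N"
  shows "left_nondegenerate (Zmod_sum m d n) (Zmod_sum m d n) G (cyclic_bracket G \<gamma> N m d n)"
  unfolding left_nondegenerate_def
proof (intro ballI impI)
  fix x
  assume x: "x \<in> carrier (Zmod_sum m d n)"
    and triv: "\<forall>y\<in>carrier (Zmod_sum m d n). cyclic_bracket G \<gamma> N m d n x y = \<one>"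
  have zero: "x i j = 0" if i: "i \<in> {1..m}" and j: "j \<in> {1..n i}" for i j
  proof -
    \<comment> \<open>The standard basis vector at position \<open>(i, j)\<close>. Its entry is
      \<open>1 mod int (d i)\<close> because for \<open>d i = 1\<close> the only representative is
      0.\<close>
    define e where
      "e = (\<lambda>a\<in>{1..m}. \<lambda>b\<in>{1..n a}. if a = i \<and> b = j then 1 mod int (d i) else 0)"
    have "e \<in> carrier (Zmod_sum m d n)"
      using d by (auto simp: carrier_Zmod_sum e_def carrier_integer_mod_group)
    then have "\<one> = cyclic_bracket G \<gamma> N m d n x e"
      using triv by simp
    \<comment> \<open>The blocks of \<open>e\<close> other than \<open>i\<close> vanish, so a single
      factor survives; the conditional has the shape that \<open>finprod_singleton\<close>
      collapses.\<close>
    also have "\<dots> = (\<Otimes>a\<in>{1..m}. if i = a then \<gamma> [^] (int (N div d a) * x a j) else \<one>)"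
      unfolding cyclic_bracket_def
    proof (rule finprod_cong')
      fix a assume a: "a \<in> {1..m}"
      show "\<gamma> [^] (int (N div d a) * dot_mod (d a) (n a) (x a) (e a)) =
            (if i = a then \<gamma> [^] (int (N div d a) * x a j) else \<one>)"
      proof (cases "i = a")
        case True
        have "dot_mod (d a) (n a) (x a) (e a) = x a j mod int (d a)"
          using True i j by (intro dot_mod_single) (auto simp: e_def)
        with True assms a show ?thesis by (simp add: pow_div_mod)
      next
        case False
        then have "dot_mod (d a) (n a) (x a) (e a) = 0"
          using a by (auto simp: dot_mod_def e_def)
        with False show ?thesis by simp
      qed
    qed (use assms(1) in auto)
    also have "\<dots> = \<gamma> [^] (int (N div d i) * x i j)"
      using i assms(1) by (subst finprod_singleton) auto
    \<comment> \<open>A power of \<gamma> is trivial exactly when the order \<open>N\<close> divides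
      the exponent.\<close>
    finally have "int N dvd int (N div d i) * x i j"
      using assms(1,2) by (metis int_pow_eq_id)
    moreover obtain k where k: "N = d i * k"
      using d[OF i] by (auto elim: dvdE)
    ultimately have "int k * int (d i) dvd int k * x i j"
      using d[OF i] by (simp add: mult.commute)
    \<comment> \<open>The cofactor \<open>k\<close> cancels, being nonzero because
      \<open>N > 0\<close>.\<close>
    then have "int (d i) dvd x i j"
      using k \<open>N > 0\<close> by simp
    \<comment> \<open>Divisibility alone gives zero only modulo \<open>d i\<close>; the range of
      representatives turns it into equality with 0.\<close>
    moreover have "x i j \<in> {0..<int (d i)}"
    proof -
      have "x i j \<in> carrier (integer_mod_group (d i))"
        using x i j unfolding carrier_Zmod_sum by blast
      then show ?thesis
        using d[OF i] by (simp add: carrier_integer_mod_group)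
    qed
    ultimately show ?thesis
      using zdvd_imp_le by force
  qed
  \<comment> \<open>Vanishing entries determine \<open>x\<close> because both it and the unit are
    \<open>undefined\<close> off the index sets, at the inner and the outer level.\<close>
  have "x i = (\<lambda>j\<in>{1..n i}. 0)" if "i \<in> {1..m}" for i
    using x that zero[OF that]
    by (intro extensionalityI[of _ "{1..n i}"]) (auto simp: carrier_Zmod_sum PiE_iff)
  moreover have "x \<in> extensional {1..m}"
    using x by (simp add: carrier_Zmod_sum PiE_iff)
  ultimately show "x = \<one>\<^bsub>Zmod_sum m d n\<^esub>"
    unfolding one_Zmod_sum by (intro extensionalityI[of x "{1..m}"]) simp_all
qed

theorem mainTheorem5:
  fixes C :: "('c, 'f) monoid_scheme" and \<gamma> :: 'c
    and N m :: nat and d n :: "nat \<Rightarrow> nat"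
  assumes "group C" and "N > 0" and "order C = N"
    and "\<gamma> \<in> carrier C" and "carrier C = generate C {\<gamma>}"
    and "\<And>i. i \<in> {1..m} \<Longrightarrow> d i > 0 \<and> d i dvd N"
    and "\<And>i. i \<in> {1..m} \<Longrightarrow> n i > 0"
  shows "pairing (Zmod_sum m d n) (Zmod_sum m d n) C (cyclic_bracket C \<gamma> N m d n)"
proof -
  interpret group C by fact
  have "carrier C = range (\<lambda>k::int. \<gamma> [^]\<^bsub>C\<^esub> k)"
    unfolding assms(5) generate_pow[OF assms(4)] by auto
  then have "comm_group C"
    using assms(4) cyclic_group cyclic_imp_abelian_group by blast
  then interpret comm_group C .
  interpret Z: comm_group "Zmod_sum m d n" by (rule comm_group_Zmod_sum)
  let ?f = "cyclic_bracket C \<gamma> N m d n"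
  \<comment> \<open>The order of \<gamma> is the size of the subgroup it generates, here all of
    \<open>C\<close>.\<close>
  have ord: "ord \<gamma> = N"
    using assms(3,4,5) by (simp add: generate_pow_card order_def)
  have closed: "?f x y \<in> carrier C" for x y
    using assms(4) by (auto simp: cyclic_bracket_def)
  have hom: "(\<lambda>x. ?f x y) \<in> hom (Zmod_sum m d n) C" for y
    by (intro homI closed cyclic_bracket_mult_left) (use assms(4,6) ord in auto)
  have left: "left_nondegenerate (Zmod_sum m d n) (Zmod_sum m d n) C ?f"
    using assms ord by (intro cyclic_bracket_left_nondegenerate) auto
  show ?thesis
  proof
    show "(\<lambda>x. ?f x y) \<in> hom (Zmod_sum m d n) C" for y
      by (rule hom)
    show "(\<lambda>y. ?f x y) \<in> hom (Zmod_sum m d n) C" for x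
      \<comment> \<open>Instantiating the first argument with \<open>x\<close> directs the symmetry
        so that the bound variable moves to the left slot, where \<open>hom\<close> applies.\<close>
      using hom[of x] by (simp add: cyclic_bracket_commute[of _ _ _ _ _ _ x])
    show "left_nondegenerate (Zmod_sum m d n) (Zmod_sum m d n) C ?f"
      by (rule left)
    then show "right_nondegenerate (Zmod_sum m d n) (Zmod_sum m d n) C ?f"
      unfolding left_nondegenerate_def right_nondegenerate_def
      by (metis cyclic_bracket_commute)
  qed
qed

end
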